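(* Let $k$ be an infinite field, and let $d,r\ge 1$ be integers such that $\binom{r+1}{2}\le 2d+1$. Then there exists a sequence of $r$ binary forms of degree $d$ over $k$ (homogeneous elements of degree $d$ of $k[x_1,x_2]$) that is quadratically independent.
   Context: A sequence $p_1,\dots,p_r$ of elements of a commutative $k$-algebra $A$ is called quadratically independent if the $\binom{r+1}{2}$ products $p_ip_j$ ($1\le i\le j\le r$) are linearly independent over $k$. *)

theory Defs
  imports Complex_Main "HOL-Computational_Algebra.Polynomial"
begin

locale commutative_algebra = vector_space scale
  for scale :: "'k::field \<Rightarrow> 'a::comm_ring_1 \<Rightarrow> 'a" (infixr \<open>*s\<close> 75) +
  assumes scale_mult_left: "c *s (x * y) = (c *s x) * y"
begin

text \<open>
  Linear independence of a family, as opposed to that of a set: a family with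
  repeated members is dependent.
\<close>

definition independent_family :: "'i set \<Rightarrow> ('i \<Rightarrow> 'a) \<Rightarrow> bool" where
  "independent_family I f \<longleftrightarrow> inj_on f I \<and> independent (f ` I)"

lemma independent_family_iff:
  assumes "finite I"
  shows "independent_family I f \<longleftrightarrow>
    (\<forall>c. (\<Sum>i\<in>I. c i *s f i) = 0 \<longrightarrow> (\<forall>i\<in>I. c i = 0))"
proof
  assume L: "independent_family I f"
  then have inj: "inj_on f I" and ind: "independent (f ` I)"
    by (auto simp: independent_family_def)
  show "\<forall>c. (\<Sum>i\<in>I. c i *s f i) = 0 \<longrightarrow> (\<forall>i\<in>I. c i = 0)"
  proof (intro allI impI ballI)
    fix c i assume s: "(\<Sum>i\<in>I. c i *s f i) = 0" and i: "i \<in> I"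
    define u where "u v = c (the_inv_into I f v)" for v
    have "(\<Sum>v\<in>f ` I. u v *s v) = (\<Sum>i\<in>I. c i *s f i)"
      by (simp add: sum.reindex[OF inj] u_def the_inv_into_f_f[OF inj])
    then have "(\<Sum>v\<in>f ` I. u v *s v) = 0"
      using s by simp
    then have "u (f i) = 0"
      using independentD[OF ind _ order_refl, of u "f i"] assms i by auto
    then show "c i = 0"
      using i by (simp add: u_def the_inv_into_f_f[OF inj])
  qed
next
  assume R: "\<forall>c. (\<Sum>i\<in>I. c i *s f i) = 0 \<longrightarrow> (\<forall>i\<in>I. c i = 0)"
  have inj: "inj_on f I"
  proof (rule inj_onI, rule ccontr)
    fix i j assume ij: "i \<in> I" "j \<in> I" "f i = f j" "i \<noteq> j"
    define c :: "'b \<Rightarrow> 'k" where "c l = (if l = i then 1 else if l = j then - 1 else 0)" for l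
    have "(\<Sum>l\<in>I. c l *s f l) = (\<Sum>l\<in>{i,j}. c l *s f l)"
      using assms ij by (intro sum.mono_neutral_right) (auto simp: c_def)
    also have "\<dots> = 0"
      using ij by (simp add: c_def)
    finally have "c i = 0"
      using R ij by blast
    then show False
      by (simp add: c_def)
  qed
  have "independent (f ` I)"
  proof (subst dependent_finite)
    show "finite (f ` I)" using assms by simp
    show "\<not> (\<exists>u. (\<exists>v\<in>f ` I. u v \<noteq> 0) \<and> (\<Sum>v\<in>f ` I. u v *s v) = 0)"
    proof
      assume "\<exists>u. (\<exists>v\<in>f ` I. u v \<noteq> 0) \<and> (\<Sum>v\<in>f ` I. u v *s v) = 0"
      then obtain u i where u: "i \<in> I" "u (f i) \<noteq> 0" "(\<Sum>v\<in>f ` I. u v *s v) = 0"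
        by auto
      then have "(\<Sum>i\<in>I. u (f i) *s f i) = 0"
        by (simp add: sum.reindex[OF inj])
      then show False
        using R[rule_format, of "\<lambda>i. u (f i)" i] u by simp
    qed
  qed
  then show "independent_family I f"
    using inj by (simp add: independent_family_def)
qed

definition quadratically_independent :: "nat \<Rightarrow> (nat \<Rightarrow> 'a) \<Rightarrow> bool" where
  "quadratically_independent r p \<longleftrightarrow>
    independent_family {(i, j). 1 \<le> i \<and> i \<le> j \<and> j \<le> r} (\<lambda>(i, j). p i * p j)"

end

text \<open>
  The polynomial ring \<open>k[x\<^sub>1, x\<^sub>2]\<close> is represented as \<open>k[x\<^sub>1][x\<^sub>2]\<close>:
  \<open>coeff (coeff f j) i\<close> is the coefficient of \<open>x\<^sub>1\<^sup>i x\<^sub>2\<^sup>j\<close> in \<open>f\<close>.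
\<close>

definition poly2_scale :: "'k::field \<Rightarrow> 'k poly poly \<Rightarrow> 'k poly poly" where
  "poly2_scale c f = smult [:c:] f"

global_interpretation poly2: commutative_algebra poly2_scale
  by unfold_locales
    (simp_all add: poly2_scale_def smult_add_right smult_add_left[symmetric] one_pCons[symmetric] mult.commute)

text \<open>The zero polynomial is a form of every degree.\<close>

definition binary_form :: "nat \<Rightarrow> 'k::field poly poly \<Rightarrow> bool" where
  "binary_form d f \<longleftrightarrow> (\<forall>i j. coeff (coeff f j) i \<noteq> 0 \<longrightarrow> i + j = d)"

end

theory Submission
  imports Defs "Jordan_Normal_Form.Determinant" "HOL-Number_Theory.Cong"
begin

text \<open>
  Let \<open>n\<close> be the odd one of \<open>r\<close> and \<open>r + 1\<close>, and give the \<open>r\<close> forms distinct residues modulo \<open>n\<close>. Let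
  \<open>p\<^sub>i\<close> be a generic form of degree \<open>d\<close> in which the exponents of \<open>x\<^sub>2\<close> are all congruent to the residue of
  \<open>p\<^sub>i\<close>. The product \<open>p\<^sub>i p\<^sub>j\<close> then has its exponents in the class of the sum of the two
  residues, and products from different classes cannot interfere. The number of products is
  \<open>n h\<close> with \<open>h = \<lfloor>(r + 1) / 2\<rfloor>\<close>; each class contains \<open>h\<close> of them, and as \<open>n h \<le> 2 d + 1\<close> it also contains
  at least \<open>h\<close> of the degrees \<open>0, \<dots>, 2 d\<close>. So the count is right in each class separately.

  What makes a single class easy is that its pairs \<open>{i, j}\<close> are disjoint, since \<open>i\<close> determines \<open>j\<close>. It is
  enough to find one choice of the forms for which the products of that class are independent, and
  monomials will do: assign to the pairs distinct degrees, and write the degree of \<open>{i, j}\<close> as a sum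
  of two exponents at most \<open>d\<close> with the prescribed residues. This is always possible except near
  \<open>0\<close> and near \<open>2 d\<close>, that is, for at most two degrees of a class; a square \<open>p\<^sub>i\<^sup>2\<close> needs an even degree, and
  this holds in every characteristic. The lemma \<open>class_slots\<close> finds such an assignment, and
  \<open>distinct_sum_exponents\<close> states the outcome.

  The choice of monomials depends on the class. In \<open>quadratically_independent_forms_if_exponents\<close>
  the choices are joined by a family of forms with polynomial coefficients in a parameter \<open>t\<close>. For
  each class the independence of its products is the nonvanishing of a determinant, a polynomial in
  \<open>t\<close> that is not zero at the node of this class, and an infinite field has a point at
  which none of these finitely many polynomials vanishes.
\<close>

section \<open>Generic forms with exponents in residue classes\<close>

text \<open>
  Independence is an open condition: the determinant of a square matrix of polynomials in
  \<open>t\<close> is a polynomial in \<open>t\<close>, and it is not zero if the matrix is a nonzero multiple of the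
  identity at a single point.
\<close>

lemma generic_independence:
  fixes F :: "'i \<Rightarrow> 'i \<Rightarrow> 'k::field poly"
  assumes "finite I" and "\<alpha> \<noteq> 0"
    and F0: "\<And>a b. a \<in> I \<Longrightarrow> b \<in> I \<Longrightarrow> poly (F a b) t0 = (if a = b then \<alpha> else 0)"
  shows "\<exists>D. D \<noteq> 0 \<and> (\<forall>t. poly D t \<noteq> 0 \<longrightarrow>
    (\<forall>c. (\<forall>b\<in>I. (\<Sum>a\<in>I. c a * poly (F a b) t) = 0) \<longrightarrow> (\<forall>a\<in>I. c a = 0)))"
proof -
  define N where "N = card I"
  obtain g where g: "bij_betw g {0..<N} I"
    using ex_bij_betw_nat_finite[OF \<open>finite I\<close>] by (auto simp: N_def)
  \<comment> \<open>Rows are indexed by the equations and columns by the unknowns.\<close>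
  define M where "M = mat N N (\<lambda>(b, a). F (g a) (g b))"
  define ev where "ev t = map_mat (\<lambda>p. poly p t) M" for t
  have det_ev: "det (ev t) = poly (det M) t" for t
  proof -
    interpret comm_ring_hom "\<lambda>p :: 'k poly. poly p t"
      by unfold_locales simp_all
    show ?thesis by (simp add: ev_def hom_det)
  qed
  have gI: "a < N \<Longrightarrow> g a \<in> I" for a
    using bij_betwE[OF g] by auto
  have ginj: "a < N \<Longrightarrow> b < N \<Longrightarrow> g a = g b \<longleftrightarrow> a = b" for a b
    using bij_betw_imp_inj_on[OF g] by (auto simp: inj_on_def)
  have "ev t0 = \<alpha> \<cdot>\<^sub>m 1\<^sub>m N"
    by (rule eq_matI) (auto simp: ev_def M_def F0 gI ginj)
  then have "det (ev t0) = \<alpha> ^ N"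
    by simp
  then have D0: "det M \<noteq> 0"
    using det_ev[of t0] \<open>\<alpha> \<noteq> 0\<close> by auto
  have "\<forall>a\<in>I. c a = 0"
    if t: "poly (det M) t \<noteq> 0" and c: "\<forall>b\<in>I. (\<Sum>a\<in>I. c a * poly (F a b) t) = 0" for t c
  proof -
    define v where "v = vec N (\<lambda>a. c (g a))"
    have "ev t *\<^sub>v v = 0\<^sub>v N"
    proof (rule eq_vecI)
      fix b assume b: "b < dim_vec (0\<^sub>v N)"
      have "(ev t *\<^sub>v v) $ b = (\<Sum>a = 0..<N. poly (F (g a) (g b)) t * c (g a))"
        using b by (simp add: ev_def M_def v_def scalar_prod_def)
      also have "\<dots> = (\<Sum>a\<in>I. poly (F a (g b)) t * c a)"
        by (rule sum.reindex_bij_betw[OF g])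
      also have "\<dots> = 0"
        using c gI b by (simp add: mult.commute)
      finally show "(ev t *\<^sub>v v) $ b = 0\<^sub>v N $ b"
        using b by simp
    qed (simp add: ev_def M_def)
    moreover have "ev t \<in> carrier_mat N N" "v \<in> carrier_vec N"
      by (simp_all add: ev_def M_def v_def)
    ultimately have v0: "v = 0\<^sub>v N"
      using t det_ev[of t] det_0_iff_vec_prod_zero[of "ev t" N] by auto
    have "c (g a) = 0" if "a < N" for a
      using arg_cong[OF v0, of "\<lambda>w. w $ a"] that by (simp add: v_def)
    then show ?thesis
      using bij_betw_imp_surj_on[OF g] by auto
  qed
  then show ?thesis
    using D0 by blast
qed

text \<open>
  If every monomial of \<open>p\<^sub>i\<close> has its exponent of \<open>x\<^sub>2\<close> in the residue class \<open>\<rho> i\<close> modulo \<open>n\<close>,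
  then products from different classes \<open>\<rho> i + \<rho> j\<close> have no monomial in common, so that each class
  \<open>s\<close> can be tested alone. For the class \<open>s\<close> the monomials with exponents \<open>u s i\<close> are a good choice
  of the forms, since their products are distinct monomials. One polynomial family in \<open>t\<close>
  passes, up to nonzero factors, through the choices for all \<open>s\<close>; each class is independent for
  almost all \<open>t\<close>, and so some \<open>t\<close> in the infinite field serves all classes at once.
\<close>

lemma quadratically_independent_forms_if_exponents:
  fixes d r n :: nat and \<rho> :: "nat \<Rightarrow> nat" and u :: "nat \<Rightarrow> nat \<Rightarrow> nat"
  assumes k: "infinite (UNIV :: 'k::field set)" and n: "n > 0"
    and ud: "\<And>s i. s < n \<Longrightarrow> i \<in> {1..r} \<Longrightarrow> u s i \<le> d"
    and un: "\<And>s i. s < n \<Longrightarrow> i \<in> {1..r} \<Longrightarrow> u s i mod n = \<rho> i"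
    and inj: "\<And>s. s < n \<Longrightarrow> inj_on (\<lambda>(i, j). u s i + u s j)
      {(i, j). 1 \<le> i \<and> i \<le> j \<and> j \<le> r \<and> (\<rho> i + \<rho> j) mod n = s}"
  shows "\<exists>p :: nat \<Rightarrow> 'k poly poly.
    (\<forall>i\<in>{1..r}. binary_form d (p i)) \<and> poly2.quadratically_independent r p"
proof -
  obtain \<tau> :: "nat \<Rightarrow> 'k" where \<tau>: "inj \<tau>"
    using infinite_countable_subset[OF k] by auto
  \<comment> \<open>Unnormalised Lagrange polynomials for the nodes \<open>\<tau> s\<close>.\<close>
  define l where "l s = (\<Prod>s'\<in>{..<n} - {s}. [:- \<tau> s', 1:])" for s
  have l0: "poly (l s) (\<tau> s') = 0" if "s' < n" "s' \<noteq> s" for s s'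
    using that by (auto simp: l_def poly_prod)
  have l1: "poly (l s) (\<tau> s) \<noteq> 0" for s
    using \<tau> by (auto simp: l_def poly_prod inj_eq)
  \<comment> \<open>The coefficient of \<open>x\<^sub>2\<^sup>v\<close> in the \<open>i\<close>-th form, as a polynomial in \<open>t\<close>.\<close>
  define C where "C i v = (\<Sum>s<n. if v = u s i then l s else 0)" for i v
  have C_eq_0: "C i v = 0" if "i \<in> {1..r}" "v > d \<or> v mod n \<noteq> \<rho> i" for i v
    using that ud un by (fastforce simp: C_def intro!: sum.neutral)
  have C_eval: "poly (C i v) (\<tau> s) = (if v = u s i then poly (l s) (\<tau> s) else 0)" if "s < n" for i v s
  proof -
    have "poly (C i v) (\<tau> s) = (\<Sum>s'<n. if v = u s' i then poly (l s') (\<tau> s) else 0)"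
      by (simp add: C_def poly_sum if_distrib[of "\<lambda>p. poly p _"] cong: if_cong)
    also have "\<dots> = (\<Sum>s'<n. if s' = s then (if v = u s i then poly (l s) (\<tau> s) else 0) else 0)"
      using that by (intro sum.cong) (auto simp: l0)
    finally show ?thesis
      using that by simp
  qed
  \<comment> \<open>The coefficient of \<open>x\<^sub>2\<^sup>e\<close> in the product of the pair \<open>ij\<close>, as a polynomial in \<open>t\<close>.\<close>
  define G where "G ij e = (\<Sum>v\<le>e. C (fst ij) v * C (snd ij) (e - v))" for ij e
  define I where "I s = {(i, j). 1 \<le> i \<and> i \<le> j \<and> j \<le> r \<and> (\<rho> i + \<rho> j) mod n = s}" for s
  define J where "J = {(i, j). 1 \<le> i \<and> i \<le> j \<and> j \<le> r}"
  define E where "E s ij = u s (fst ij) + u s (snd ij)" for s ij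
  have finJ: "finite J"
    by (rule finite_subset[of _ "{1..r} \<times> {1..r}"]) (auto simp: J_def)
  have IJ: "I s \<subseteq> J" for s
    by (auto simp: I_def J_def)
  have finI: "finite (I s)" for s
    using finJ IJ finite_subset by blast
  have G_eval: "poly (G ij e) (\<tau> s) = (if e = E s ij then (poly (l s) (\<tau> s))\<^sup>2 else 0)"
    if "s < n" for s ij e
  proof -
    have "poly (G ij e) (\<tau> s) = (\<Sum>v\<le>e. if v = u s (fst ij)
        then (if e = E s ij then (poly (l s) (\<tau> s))\<^sup>2 else 0) else 0)"
      unfolding G_def poly_sum poly_mult C_eval[OF that]
      by (rule sum.cong) (auto simp: E_def power2_eq_square)
    then show ?thesis
      by (auto simp: E_def)
  qed
  have injE: "inj_on (E s) (I s)" if "s < n" for s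
  proof -
    have "E s = (\<lambda>(i, j). u s i + u s j)"
      by (simp add: fun_eq_iff E_def)
    then show ?thesis
      using inj[OF that] by (simp add: I_def)
  qed
  define good where "good s t \<longleftrightarrow> (\<forall>c. (\<forall>b\<in>I s. (\<Sum>a\<in>I s. c a * poly (G a (E s b)) t) = 0)
      \<longrightarrow> (\<forall>a\<in>I s. c a = 0))" for s t
  have "\<exists>D. D \<noteq> 0 \<and> (\<forall>t. poly D t \<noteq> 0 \<longrightarrow> good s t)" if s: "s < n" for s
    unfolding good_def
  proof (rule generic_independence[where \<alpha> = "(poly (l s) (\<tau> s))\<^sup>2" and ?t0.0 = "\<tau> s"])
    fix a b assume ab: "a \<in> I s" "b \<in> I s"
    then show "poly (G a (E s b)) (\<tau> s) = (if a = b then (poly (l s) (\<tau> s))\<^sup>2 else 0)"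
      unfolding G_eval[OF s] inj_on_eq_iff[OF injE[OF s] ab(2,1)] by (simp add: eq_commute)
  qed (use l1 finI in auto)
  then obtain D where D0: "D s \<noteq> 0" and D: "poly (D s) t \<noteq> 0 \<Longrightarrow> good s t" if "s < n" for s t
    by metis
  have "(\<Prod>s<n. D s) \<noteq> 0"
    using D0 by simp
  then have "finite {t. poly (\<Prod>s<n. D s) t = 0}"
    by (rule poly_roots_finite)
  then obtain t where "poly (\<Prod>s<n. D s) t \<noteq> 0"
    using k by (metis (mono_tags, lifting) UNIV_eq_I mem_Collect_eq)
  then have t: "poly (D s) t \<noteq> 0" if "s < n" for s
    using that by (auto simp: poly_prod)
  define p where "p i = (\<Sum>v\<le>d. monom (monom (poly (C i v) t) (d - v)) v)" for i
  have coeff_p: "coeff (p i) v = (if v \<le> d then monom (poly (C i v) t) (d - v) else 0)" for i v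
    by (simp add: p_def coeff_sum)
  have form: "binary_form d (p i)" for i
    by (auto simp: binary_form_def coeff_p split: if_splits)
  have p1: "poly (coeff (p i) v) 1 = poly (C i v) t" if "i \<in> {1..r}" for i v
    using C_eq_0[OF that, of v] by (auto simp: coeff_p poly_monom)
  \<comment> \<open>A relation is read off in degree \<open>e\<close> of \<open>x\<^sub>2\<close>, with \<open>x\<^sub>1\<close> set to 1.\<close>
  have "\<forall>a\<in>J. c a = 0" if c: "(\<Sum>a\<in>J. poly2_scale (c a) ((\<lambda>(i, j). p i * p j) a)) = 0" for c
  proof -
    have G0: "(\<Sum>a\<in>J. c a * poly (G a e) t) = 0" for e
    proof -
      have "poly (coeff (\<Sum>a\<in>J. poly2_scale (c a) ((\<lambda>(i, j). p i * p j) a)) e) 1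
          = (\<Sum>a\<in>J. c a * (\<Sum>v\<le>e. poly (coeff (p (fst a)) v) 1 * poly (coeff (p (snd a)) (e - v)) 1))"
        by (simp add: coeff_sum poly_sum poly2_scale_def split_beta coeff_mult)
      also have "\<dots> = (\<Sum>a\<in>J. c a * poly (G a e) t)"
        by (intro sum.cong refl) (auto simp: G_def poly_sum p1 J_def)
      finally show ?thesis
        using c by simp
    qed
    have "\<forall>a\<in>I s. c a = 0" if s: "s < n" for s
    proof -
      have "\<forall>b\<in>I s. (\<Sum>a\<in>I s. c a * poly (G a (E s b)) t) = 0"
      proof
        fix b assume b: "b \<in> I s"
        have Eb: "E s b mod n = s"
          using b s un[OF s, of "fst b"] un[OF s, of "snd b"]
          by (auto simp: E_def I_def mod_add_eq[of "u s (fst b)" n, symmetric] split_beta)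
        have "G a (E s b) = 0" if a: "a \<in> J - I s" for a
          unfolding G_def
        proof (rule sum.neutral, rule ballI)
          fix v assume v: "v \<in> {..E s b}"
          have "v mod n \<noteq> \<rho> (fst a) \<or> (E s b - v) mod n \<noteq> \<rho> (snd a)"
          proof (rule ccontr)
            assume "\<not> ?thesis"
            then have "(\<rho> (fst a) + \<rho> (snd a)) mod n = (v mod n + (E s b - v) mod n) mod n"
              by simp
            also have "\<dots> = s"
              using v Eb by (simp add: mod_add_eq)
            finally show False
              using a by (auto simp: I_def J_def)
          qed
          then show "C (fst a) v * C (snd a) (E s b - v) = 0"
            using a C_eq_0[of "fst a" v] C_eq_0[of "snd a" "E s b - v"] by (auto simp: J_def)
        qed
        then have "(\<Sum>a\<in>I s. c a * poly (G a (E s b)) t) = (\<Sum>a\<in>J. c a * poly (G a (E s b)) t)"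
          using IJ finJ by (intro sum.mono_neutral_left) auto
        then show "(\<Sum>a\<in>I s. c a * poly (G a (E s b)) t) = 0"
          by (simp add: G0)
      qed
      then show ?thesis
        using D[OF s t[OF s]] by (simp add: good_def)
    qed
    moreover have "J \<subseteq> (\<Union>s<n. I s)"
      using n by (auto simp: I_def J_def)
    ultimately show ?thesis
      by blast
  qed
  then have "poly2.quadratically_independent r p"
    unfolding poly2.quadratically_independent_def J_def[symmetric]
    by (subst poly2.independent_family_iff[OF finJ]) blast
  then show ?thesis
    using form by blast
qed

section \<open>Monomials with distinct products in a residue class\<close>

text \<open>
  At most \<open>h\<close> objects are to be placed in the slots \<open>0, \<dots>, h - 1\<close>. Every object but \<open>q\<close> fits in each
  inner slot, so that only the two end slots and the object \<open>q\<close> need attention: once they are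
  settled, any injection of the other objects into the other slots will do.
\<close>

lemma slot_assignment:
  fixes h :: nat and ok :: "'a \<Rightarrow> nat \<Rightarrow> bool"
  assumes D: "finite D" "card D \<le> h"
    and xy: "x \<in> D" "y \<in> D" "x \<noteq> y" "ok x 0" "ok y (h - 1)"
    and mid: "\<And>a k. a \<in> D \<Longrightarrow> a \<noteq> q \<Longrightarrow> 0 < k \<Longrightarrow> k < h - 1 \<Longrightarrow> ok a k"
    and q: "q \<in> D \<Longrightarrow> q = x \<or> q = y \<or> (\<exists>z. 0 < z \<and> z < h - 1 \<and> ok q z)"
  shows "\<exists>f. inj_on f D \<and> (\<forall>a\<in>D. f a < h \<and> ok a (f a))"
proof -
  have "card {x, y} \<le> card D"
    using xy D by (intro card_mono) auto
  then have h: "h \<ge> 2"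
    using xy D by simp
  obtain S g where S: "S \<subseteq> D" "{x, y} \<subseteq> S" "q \<in> D \<Longrightarrow> q \<in> S"
    and g: "inj_on g S" "\<And>a. a \<in> S \<Longrightarrow> g a < h \<and> ok a (g a)" "g x = 0" "g y = h - 1"
  proof (cases "q \<in> D \<and> q \<noteq> x \<and> q \<noteq> y")
    case True
    then obtain z where z: "0 < z" "z < h - 1" "ok q z"
      using q by blast
    show ?thesis
      by (rule that[of "{x, y, q}" "\<lambda>a. if a = x then 0 else if a = y then h - 1 else z"])
        (use True z xy h in \<open>auto simp: inj_on_def\<close>)
  next
    case False
    show ?thesis
      by (rule that[of "{x, y}" "\<lambda>a. if a = x then 0 else h - 1"])
        (use False xy h in \<open>auto simp: inj_on_def\<close>)
  qed
  have "card (D - S) = card D - card S" "card ({..<h} - g ` S) = h - card S"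
    using S g D by (auto simp: card_Diff_subset finite_subset card_image image_subset_iff)
  then obtain f where f: "f ` (D - S) \<subseteq> {..<h} - g ` S" "inj_on f (D - S)"
    using card_le_inj[of "D - S" "{..<h} - g ` S"] D diff_le_mono[OF D(2), of "card S"] by auto
  have fr: "f a < h" "f a \<notin> g ` S" if "a \<in> D" "a \<notin> S" for a
    using f(1) that by auto
  define k where "k a = (if a \<in> S then g a else f a)" for a
  have "inj_on k D"
  proof (rule inj_onI)
    fix a b assume "a \<in> D" "b \<in> D" "k a = k b"
    then show "a = b"
      using fr g(1) f(2) unfolding k_def inj_on_def by (metis DiffI imageI)
  qed
  moreover have "k a < h \<and> ok a (k a)" if a: "a \<in> D" for a
  proof (cases "a \<in> S")
    case True
    then show ?thesis using g(2) by (simp add: k_def)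
  next
    case False
    then have "f a \<noteq> 0" "f a \<noteq> h - 1" "f a < h" "a \<noteq> q"
      using fr[OF a False] S g(3,4) a by force+
    then show ?thesis
      using mid[OF a, of "f a"] False by (auto simp: k_def)
  qed
  ultimately show ?thesis by blast
qed

text \<open>
  The degree \<open>e\<close> is a sum of two exponents at most \<open>d\<close>, the first of which has residue \<open>a\<close>. If the
  second one has residue \<open>a\<close> too, then both belong to the same form and have to be equal.
\<close>

definition splits :: "nat \<Rightarrow> nat \<Rightarrow> nat \<Rightarrow> nat \<Rightarrow> bool" where
  "splits n d e a \<longleftrightarrow> (\<exists>w\<le>d. w \<le> e \<and> e - w \<le> d \<and> w mod n = a \<and>
    (2 * a mod n = e mod n \<longrightarrow> 2 * w = e))"

text \<open>
  The admissible \<open>w\<close> fill the interval from \<open>e - d\<close> (truncated at 0) to \<open>min d e\<close>. If \<open>e\<close> is at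
  distance at least \<open>n - 1\<close> from both \<open>0\<close> and \<open>2 * d\<close>, it has at least \<open>n\<close> elements and so meets
  every residue class.
\<close>

lemma splits_middle:
  assumes "a < n" "n - 1 \<le> e" "e + n - 1 \<le> 2 * d" "2 * a mod n \<noteq> e mod n"
  shows "splits n d e a"
proof -
  define L where "L = e - d"
  \<comment> \<open>The least number from \<open>L\<close> on that has residue \<open>a\<close>.\<close>
  define w where "w = L + (a + (n - L mod n)) mod n"
  have n: "n > 0" using assms by simp
  have "w mod n = (L mod n + (a + (n - L mod n))) mod n"
    unfolding w_def by (metis mod_add_left_eq mod_add_right_eq)
  also have "L mod n + (a + (n - L mod n)) = a + n"
    using mod_less_divisor[OF n, of L] by linarith
  finally have 1: "w mod n = a"
    using assms by simp
  have 2: "L \<le> w" "w \<le> L + (n - 1)"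
    using mod_less_divisor[OF n, of "a + (n - L mod n)"] n unfolding w_def by linarith+
  have "w \<le> d" "w \<le> e" "e - w \<le> d"
    using 2 assms unfolding L_def by linarith+
  then show ?thesis
    unfolding splits_def using 1 assms(4) by blast
qed

lemma splits_square:
  assumes "odd n" "a < n" "2 * a mod n = e mod n" "even e" "e \<le> 2 * d"
  shows "splits n d e a"
proof -
  obtain w where w: "e = 2 * w"
    using \<open>even e\<close> by blast
  have "[2 * w = 2 * a] (mod n)"
    using assms w by (simp add: cong_def)
  then have "[w = a] (mod n)"
    using \<open>odd n\<close> cong_mult_lcancel_nat[of 2 n w a] by simp
  then have "w mod n = a"
    using \<open>a < n\<close> by (simp add: cong_def)
  then show ?thesis
    unfolding splits_def using w assms by (intro exI[of _ w]) auto
qed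

lemma splits_nonsquare:
  assumes "w \<le> d" "w \<le> s + n * k" "s + n * k - w \<le> d" "w mod n = a"
    and "s < n" "2 * a \<noteq> s" "2 * a \<noteq> n + s"
  shows "splits n d (s + n * k) a"
proof -
  have "a < n" using assms by auto
  then have "2 * a mod n \<noteq> s"
    using assms by (cases "2 * a < n") (auto simp: le_mod_geq)
  then show ?thesis
    unfolding splits_def using assms by (intro exI[of _ w]) auto
qed

definition partner :: "nat \<Rightarrow> nat \<Rightarrow> nat \<Rightarrow> nat" where
  "partner n s a = (if a \<le> s then s - a else n + s - a)"

text \<open>
  The pairs of residues with sum \<open>s\<close> modulo \<open>n = 2 * m + 1\<close> are represented by their smaller
  members, which form \<open>D\<close>. If \<open>h = m\<close>, the residue \<open>m + 1\<close> is discarded, and with it exactly one pair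
  of each class, so that \<open>D\<close> has \<open>h\<close> elements in either case, as many as there are slots, that is,
  degrees \<open>s + n * k\<close> with \<open>k < h\<close>. The bound \<open>d\<close> is the least one for which these degrees reach at
  most \<open>2 * d\<close> for all \<open>s\<close>. The square, the pair of \<open>c\<close> with itself, needs an even degree.

  The pairs for the two ends are found by hand. Degree \<open>s\<close> splits for \<open>a \<le> s\<close>, and the square
  itself stands there if \<open>s\<close> is even, unless \<open>s = 2 * m\<close> and \<open>h\<close> is odd, when no other pair reaches
  the top degree. At the top one counts down from \<open>d\<close>, whose residue is \<open>m\<close> for odd \<open>h\<close> and \<open>0\<close> for
  even \<open>h\<close>. The small deviations from the pairs \<open>{0, s}\<close> at the bottom and \<open>{d, s - d}\<close> at the top
  avoid the discarded residue or the use of one pair at both ends. The choice of the discarded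
  residue matters: without the residue \<open>0\<close>, for instance, no pair would be left for the degree \<open>0\<close>.
\<close>

lemma class_slots:
  fixes m h s :: nat
  defines "n \<equiv> 2 * m + 1"
  defines "d \<equiv> n * h div 2"
  defines "R \<equiv> {a. a < n \<and> (h = m \<longrightarrow> a \<noteq> m + 1)}"
  defines "D \<equiv> {a \<in> R. partner n s a \<in> R \<and> a \<le> partner n s a}"
  assumes h: "h = m \<or> h = m + 1" "h \<ge> 2" and s: "s < n"
  shows "\<exists>f. inj_on f D \<and> (\<forall>a\<in>D. f a < h \<and> splits n d (s + n * f a) a)"
proof -
  define c where "c = (if even s then s div 2 else (n + s) div 2)"
  have c: "2 * a = s \<or> 2 * a = n + s \<longleftrightarrow> a = c" for a
    by (auto simp: c_def n_def) presburger+
  have c_eq: "2 * c = s \<or> 2 * c = n + s"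
    using c[of c] by blast
  have nonsquare: "2 * a \<noteq> s" "2 * a \<noteq> n + s" if "a \<noteq> c" for a
    using c[of a] that by blast+
  have m: "m \<ge> 1" using h by auto
  have D_fin: "finite D"
    by (auto simp: D_def R_def)
  have D_card: "card D \<le> h"
  proof -
    let ?E = "{..s div 2} \<union> {s<..(n + s) div 2}"
    have E: "card ?E = m + 1"
      using s by (subst card_Un_disjoint) (auto simp: n_def)
    have DE: "D \<subseteq> ?E"
      by (auto simp: D_def partner_def split: if_splits)
    show ?thesis
    proof (cases "h = m")
      case True
      \<comment> \<open>The representative of the pair that contains the discarded residue.\<close>
      define o' where "o' = min (m + 1) (partner n s (m + 1))"
      have "o' \<in> ?E"
        using s m by (auto simp: o'_def partner_def n_def)
      moreover have "o' \<notin> D"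
        using True s m by (auto simp: o'_def D_def R_def partner_def n_def min_def split: if_splits)
      ultimately have "D \<subseteq> ?E - {o'}" "card (?E - {o'}) = m"
        using DE E by auto
      then show ?thesis
        using True card_mono[of "?E - {o'}" D] by simp
    next
      case False
      then show ?thesis
        using h E card_mono[OF _ DE] by simp
    qed
  qed
  have nh: "n * h \<le> 2 * d + 1"
    by (simp add: d_def)
  have mid: "splits n d (s + n * k) a" if "a \<in> D" "a \<noteq> c" "0 < k" "k < h - 1" for a k
  proof (rule splits_middle)
    show "a < n" using that by (simp add: D_def R_def)
    have "n \<le> n * k" "n * (k + 2) \<le> n * h"
      using that by (simp, intro mult_le_mono2, simp)
    then show "n - 1 \<le> s + n * k" "s + n * k + n - 1 \<le> 2 * d"
      using nh s unfolding add_mult_distrib2 by linarith+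
    show "2 * a mod n \<noteq> (s + n * k) mod n"
      using \<open>a < n\<close> s nonsquare[OF that(2)] by (cases "2 * a < n") (auto simp: le_mod_geq)
  qed
  have sq: "splits n d (s + n * k) c" if "k < h" "even (s + k)" for k
  proof (rule splits_square)
    show "odd n" "even (s + n * k)" using that by (auto simp: n_def)
    show "c < n" using s by (auto simp: c_def n_def elim!: oddE)
    show "2 * c mod n = (s + n * k) mod n"
      using c_eq by (elim disjE) (simp_all only: mod_mult_self2 mod_add_self1)
    have "n * (k + 1) \<le> n * h"
      using that by (intro mult_le_mono2; simp)
    then show "s + n * k \<le> 2 * d"
      using nh s by (auto simp: algebra_simps)
  qed
  have low: "splits n d (s + n * 0) a" if "a \<le> s" "a \<noteq> c" for a
  proof (rule splits_nonsquare)
    have "n * 2 \<le> n * h" using h by (intro mult_le_mono2)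
    then have "n \<le> d"  unfolding d_def by linarith
    then show "a \<le> d" "s + n * 0 - a \<le> d" using that s by auto
  qed (use that s nonsquare[OF that(2)] in auto)
  have "\<exists>x\<in>D. \<exists>y\<in>D. x \<noteq> y \<and> splits n d (s + n * 0) x \<and> splits n d (s + n * (h - 1)) y \<and>
      (c \<in> D \<longrightarrow> c = x \<or> c = y \<or> (\<exists>z. 0 < z \<and> z < h - 1 \<and> splits n d (s + n * z) c))"
  proof (cases "odd h")
    case True
    then obtain q where q: "h = 2 * q + 1" by (elim oddE)
    have q1: "q \<ge> 1" using h q by auto
    define z where "z = n * q"
    have z: "n \<le> z" "n * (h - 1) = 2 * z" "z mod n = 0"
      using q1 by (auto simp: z_def q)
    have d: "d = z + m"
      by (simp add: d_def q z_def n_def algebra_simps)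
    have mn: "m < n" by (simp add: n_def)
    have m2: "m \<ge> 2" using h q q1 by auto
    have top: "splits n d (s + n * (h - 1)) a" if "w \<le> d" "s + z \<le> w + m" "w mod n = a" "a \<noteq> c" for a w
      by (rule splits_nonsquare[where w = w]) (use that(1-3) z d s mn nonsquare[OF that(4)] in auto)
    \<comment> \<open>The pair \<open>{m, s - m}\<close> takes the top slot, with the exponent \<open>d\<close> for the residue \<open>m\<close>.\<close>
    have y: "\<exists>y\<in>D. y \<noteq> c \<and> y = (if s \<ge> m then s - m else m) \<and> splits n d (s + n * (h - 1)) y"
      if "s \<noteq> 2 * m" "s \<noteq> 0"
    proof (cases "s \<ge> m")
      case True
      have "s - m \<noteq> c" using that True s by (auto simp: c_def n_def)
      moreover have "(s + z - m) mod n = s - m"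
        using True s z(3) by (metis Nat.add_diff_assoc2 add.right_neutral less_imp_diff_less mod_add_right_eq mod_less)
      ultimately have "splits n d (s + n * (h - 1)) (s - m)"
        using True s by (intro top[of "s + z - m"]) (auto simp: d n_def)
      moreover have "s - m \<in> D"
        using True s m2 by (auto simp: D_def R_def partner_def n_def)
      ultimately show ?thesis using True \<open>s - m \<noteq> c\<close> by auto
    next
      case False
      have "m \<noteq> c" using that False s by (auto simp: c_def n_def)
      moreover have "d mod n = m"
        using mn by (simp add: d z_def)
      ultimately have "splits n d (s + n * (h - 1)) m"
        using False by (intro top[of d]) (auto simp: d)
      moreover have "m \<in> D"
        using False that by (auto simp: D_def R_def partner_def n_def)
      ultimately show ?thesis using False \<open>m \<noteq> c\<close> by auto
    qed
    consider "s = 0" | "s = 2 * m" | "even s" "s \<noteq> 0" "s \<noteq> 2 * m" | "odd s" by blast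
    then show ?thesis
    proof cases
      case 1
      \<comment> \<open>Here \<open>{m, s - m}\<close> would be \<open>{m, m + 1}\<close>; the exponent \<open>d - 1\<close> gives \<open>{m - 1, m + 2}\<close>.\<close>
      have "d - 1 = m - 1 + n * q"
        using m2 by (simp add: d z_def)
      then have "(d - 1) mod n = m - 1"
        using mn by simp
      then have "splits n d (s + n * (h - 1)) (m - 1)"
        using m2 1 by (intro top[of "d - 1"]) (auto simp: d c_def)
      then show ?thesis
        using 1 m2 sq[of 0] h by (intro bexI[of _ c] bexI[of _ "m - 1"])
          (auto simp: c_def D_def R_def partner_def n_def)
    next
      case 2
      then show ?thesis
        using m2 sq[of "h - 1"] h q low[of 0] by (intro bexI[of _ 0] bexI[of _ c])
          (auto simp: c_def D_def R_def partner_def n_def)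
    next
      case 3
      then have "c \<in> D"
        using s by (auto simp: c_def D_def R_def partner_def n_def)
      moreover obtain y where "y \<in> D" "y \<noteq> c" "splits n d (s + n * (h - 1)) y"
        using y[OF 3(3,2)] by blast
      ultimately show ?thesis
        using 3 sq[of 0] h by (intro bexI[of _ c] bexI[of _ y]) auto
    next
      case 4
      \<comment> \<open>The square goes to slot 1; \<open>{1, m - 1}\<close> replaces \<open>{0, m}\<close> at the bottom if the latter
        is needed at the top.\<close>
      have sq1: "splits n d (s + n * 1) c" and h2: "h - 1 > 1"
        using sq[of 1] 4 q q1 by auto
      have s_ne: "s \<noteq> 2 * m" "s \<noteq> 0"
        using 4 by (auto simp: odd_pos)
      obtain y where yD: "y \<in> D" "y = (if s \<ge> m then s - m else m)"
          "splits n d (s + n * (h - 1)) y"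
        using y[OF s_ne] by blast
      define x :: nat where "x = (if s = m then 1 else 0)"
      have "x \<in> D"
        using 4 s m2 q by (auto simp: x_def D_def R_def partner_def n_def)
      moreover have "x \<noteq> y"
        using m2 by (auto simp: x_def yD(2))
      moreover have "splits n d (s + n * 0) x"
        using m2 4 by (intro low) (auto simp: x_def c_def n_def)
      ultimately show ?thesis
        using yD sq1 h2 by (intro bexI[of _ x] bexI[of _ y]) auto
    qed
  next
    case False
    then obtain q where q: "h = 2 * q" by (metis evenE)
    have q1: "q \<ge> 1" using h q by auto
    define z where "z = n * (q - 1)"
    have d: "d = z + n" and z: "n * (h - 1) = 2 * z + n"
      using q1 by (auto simp: d_def q z_def algebra_simps)
    have top: "splits n d (s + n * (h - 1)) a" if "a < n" "a \<noteq> c" "s \<le> a" for a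
      by (rule splits_nonsquare[where w = "z + a"])
        (use that(1,3) z d s nonsquare[OF that(2)] in \<open>auto simp: z_def\<close>)
    have top0: "splits n d (s + n * (h - 1)) 0" if "c \<noteq> 0"
      by (rule splits_nonsquare[where w = d])
        (use z d s nonsquare[of 0] that in \<open>auto simp: z_def\<close>)
    have sq_top: "splits n d (s + n * (h - 1)) c" if "odd s"
      using that sq[of "h - 1"] q q1 by auto
    consider "s = 0" | "even s" "s \<noteq> 0" | "s = 1" "h = m" | "odd s" "\<not> (s = 1 \<and> h = m)" by blast
    then show ?thesis
    proof cases
      case 1
      then show ?thesis
        using m h q sq[of 0] top[of 1] by (intro bexI[of _ c] bexI[of _ 1])
          (auto simp: c_def D_def R_def partner_def n_def)
    next
      case 2
      then have "c \<in> D"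
        using s by (auto simp: c_def D_def R_def partner_def n_def)
      moreover have "0 \<in> D"
        using 2 s q h by (auto simp: D_def R_def partner_def n_def)
      ultimately show ?thesis
        using 2 h sq[of 0] top0 by (intro bexI[of _ c] bexI[of _ 0]) (auto simp: c_def)
    next
      case 3
      \<comment> \<open>The one class with a discarded square: \<open>{0, 1}\<close> and \<open>{2, 2 * m}\<close> take the ends.\<close>
      have "c \<notin> D"
        using 3 by (auto simp: c_def D_def R_def n_def)
      moreover have "2 \<in> D" "0 \<in> D" "c \<noteq> 2" "c \<noteq> 0" "n > 2"
        using 3 q h by (auto simp: c_def D_def R_def partner_def n_def)
      ultimately show ?thesis
        using 3 top[of 2] low[of 0] by (intro bexI[of _ 0] bexI[of _ 2]) auto
    next
      case 4
      \<comment> \<open>The square is at the top; \<open>{1, m}\<close> avoids the discarded residue in \<open>{0, m + 1}\<close>.\<close>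
      define x :: nat where "x = (if s = m + 1 \<and> h = m then 1 else 0)"
      obtain b where b: "s = 2 * b + 1"
        using 4(1) by (elim oddE)
      have cb: "c = m + b + 1" "b < m"
        using b s by (simp_all add: c_def n_def)
      have "x \<in> D"
      proof (cases "s = m + 1 \<and> h = m")
        case True
        then have "partner n s 1 = m" "x = 1"
          by (simp_all add: partner_def x_def)
        then show ?thesis
          using m True h(2) by (simp add: D_def R_def n_def)
      next
        case False
        then have "partner n s 0 = s" "x = 0"
          by (auto simp: partner_def x_def)
        then show ?thesis
          using s False by (auto simp: D_def R_def n_def)
      qed
      moreover have "c \<in> D"
      proof -
        have "partner n s c = c"
          using cb b by (simp add: partner_def n_def)
        moreover have "h = m \<longrightarrow> b \<noteq> 0"
          using 4(2) b by auto
        ultimately show ?thesis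
          using cb by (simp add: D_def R_def n_def)
      qed
      moreover have "x \<noteq> c" "x \<le> s"
        using cb b m by (auto simp: x_def)
      moreover have "splits n d (s + n * (h - 1)) c"
        using 4(1) by (rule sq_top)
      ultimately show ?thesis
        using low[of x] by blast
    qed
  qed
  then obtain x y where xy: "x \<in> D" "y \<in> D" "x \<noteq> y"
      "splits n d (s + n * 0) x" "splits n d (s + n * (h - 1)) y"
      and c_slot: "c \<in> D \<longrightarrow> c = x \<or> c = y \<or>
        (\<exists>z. 0 < z \<and> z < h - 1 \<and> splits n d (s + n * z) c)"
    by blast
  show ?thesis
    by (rule slot_assignment[OF D_fin D_card, of x y "\<lambda>a k. splits n d (s + n * k) a" c, OF xy];
        (rule mid c_slot[rule_format]; assumption)?)
qed

text \<open>
  A residue lies in only one pair with sum \<open>s\<close>, so the splittings of the degrees assigned to the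
  pairs can be chosen independently. Distinct slots give distinct degrees.
\<close>

lemma class_exponents:
  fixes m h s :: nat
  defines "n \<equiv> 2 * m + 1"
  defines "d \<equiv> n * h div 2"
  defines "R \<equiv> {a. a < n \<and> (h = m \<longrightarrow> a \<noteq> m + 1)}"
  assumes h: "h = m \<or> h = m + 1" "h \<ge> 2" and s: "s < n"
  shows "\<exists>u. (\<forall>a\<in>R. u a \<le> d \<and> u a mod n = a) \<and>
    inj_on (\<lambda>(a, b). u a + u b) {(a, b). a \<in> R \<and> b \<in> R \<and> a \<le> b \<and> (a + b) mod n = s}"
proof -
  define D where "D = {a \<in> R. partner n s a \<in> R \<and> a \<le> partner n s a}"
  obtain f where f: "inj_on f D" "\<And>a. a \<in> D \<Longrightarrow> splits n d (s + n * f a) a"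
    using class_slots[OF h s[unfolded n_def]] unfolding D_def R_def d_def n_def by blast
  have "\<forall>a\<in>D. \<exists>w. w \<le> d \<and> w \<le> s + n * f a \<and> s + n * f a - w \<le> d \<and> w mod n = a \<and>
      (2 * a mod n = s \<longrightarrow> 2 * w = s + n * f a)"
    using f(2) s by (simp add: splits_def)
  then obtain w where "\<forall>a\<in>D. w a \<le> d \<and> w a \<le> s + n * f a \<and> s + n * f a - w a \<le> d \<and>
      w a mod n = a \<and> (2 * a mod n = s \<longrightarrow> 2 * w a = s + n * f a)"
    by (rule bchoice[THEN exE])
  then have w: "w a \<le> d" "w a \<le> s + n * f a" "s + n * f a - w a \<le> d" "w a mod n = a"
      "2 * a mod n = s \<Longrightarrow> 2 * w a = s + n * f a" if "a \<in> D" for a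
    using that by blast+
  define u where "u a = (if a \<in> D then w a
      else if a \<in> R \<and> partner n s a \<in> R then s + n * f (partner n s a) - w (partner n s a)
      else a)" for a
  have n: "n > 0" by (simp add: n_def)
  have nd: "n \<le> d"
    using mult_le_mono2[OF h(2), of n] unfolding d_def by linarith
  have partner: "b = partner n s a" if "a < n" "b < n" "(a + b) mod n = s" for a b
    using that by (cases "a + b < n") (auto simp: partner_def le_mod_geq)
  have partner_sum: "(a + partner n s a) mod n = s" "partner n s a < n" if "a < n" for a
    using that s by (auto simp: partner_def)
  have RD: "partner n s a \<in> D" "partner n s (partner n s a) = a"
    if "a \<in> R" "a \<notin> D" "partner n s a \<in> R" for a
  proof -
    show "partner n s (partner n s a) = a"
      using partner[of "partner n s a" a] partner_sum[of a] that by (auto simp: R_def add.commute)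
    then show "partner n s a \<in> D"
      using that by (auto simp: D_def)
  qed
  have u: "u a \<le> d \<and> u a mod n = a" if a: "a \<in> R" for a
  proof (cases "a \<notin> D \<and> partner n s a \<in> R")
    case True
    define b where "b = partner n s a"
    have b: "b \<in> D" "partner n s b = a" "a < n" "b < n" "u a = s + n * f b - w b"
      using RD True a by (auto simp: b_def u_def R_def)
    have "(b + u a) mod n = (w b + u a) mod n"
      using w(4)[OF b(1)] by (metis mod_add_left_eq)
    also have "w b + u a = s + n * f b"
      using w(2)[OF b(1)] b by simp
    finally have "(b + u a mod n) mod n = s"
      using s by (simp add: mod_add_right_eq)
    then have "u a mod n = a"
      using partner[of b "u a mod n"] b n by simp
    then show ?thesis
      using w(3)[OF b(1)] b by simp
  next
    case False
    then show ?thesis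
      using w nd a by (auto simp: u_def R_def)
  qed
  have sum: "a \<in> D \<and> u a + u b = s + n * f a"
    if "a \<in> R" "b \<in> R" "a \<le> b" "(a + b) mod n = s" for a b
  proof -
    have b: "partner n s a = b" "partner n s b = a"
      using that partner[of a b, symmetric] partner[of b a, symmetric]
      by (simp_all add: R_def add.commute)
    then have a: "a \<in> D"
      using that by (simp add: D_def)
    show ?thesis
    proof (cases "a = b")
      case True
      then show ?thesis
        using a w(5)[OF a] that by (simp add: u_def flip: mult_2)
    next
      case False
      then have "b \<notin> D"
        using b that by (auto simp: D_def)
      then show ?thesis
        using a b that w(2)[OF a] by (simp add: u_def)
    qed
  qed
  have "inj_on (\<lambda>(a, b). u a + u b) {(a, b). a \<in> R \<and> b \<in> R \<and> a \<le> b \<and> (a + b) mod n = s}"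
  proof (rule inj_onI)
    fix x y
    assume "x \<in> {(a, b). a \<in> R \<and> b \<in> R \<and> a \<le> b \<and> (a + b) mod n = s}"
      and "y \<in> {(a, b). a \<in> R \<and> b \<in> R \<and> a \<le> b \<and> (a + b) mod n = s}"
      and eq: "(\<lambda>(a, b). u a + u b) x = (\<lambda>(a, b). u a + u b) y"
    then obtain a b a' b' where x: "x = (a, b)" "a \<in> R" "b \<in> R" "a \<le> b" "(a + b) mod n = s"
      and y: "y = (a', b')" "a' \<in> R" "b' \<in> R" "a' \<le> b'" "(a' + b') mod n = s"
      by blast
    have "a \<in> D" "a' \<in> D" "n * f a = n * f a'"
      using sum[OF x(2-5)] sum[OF y(2-5)] eq x(1) y(1) by simp_all
    then have "a = a'"
      using inj_onD[OF f(1)] n by simp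
    moreover have "b = partner n s a" "b' = partner n s a'"
      using partner[OF _ _ x(5)] partner[OF _ _ y(5)] x y by (simp_all add: R_def)
    ultimately show "x = y"
      using x(1) y(1) by simp
  qed
  then show ?thesis
    using u by blast
qed

text \<open>
  The modulus \<open>n\<close> is the odd one of \<open>r\<close> and \<open>r + 1\<close>, and \<open>h = (r + 1) div 2\<close>; then
  \<open>n * h = (r + 1) choose 2\<close>, which is to say that the products are spread evenly over the \<open>n\<close> classes.
  The indices are sent to the residues in increasing order, so that the smaller index of a pair
  has the smaller residue. For \<open>r \<le> 2\<close> a class modulo 3 has at most one pair, and the
  exponents 0 and 1 do.
\<close>

lemma distinct_sum_exponents:
  fixes r d :: nat
  assumes "(r + 1) choose 2 \<le> 2 * d + 1" "d \<ge> 1"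
  shows "\<exists>n \<rho> u. n > 0 \<and>
    (\<forall>s<n. (\<forall>i\<in>{1..r}. u s i \<le> d \<and> u s i mod n = \<rho> i) \<and>
      inj_on (\<lambda>(i, j). u s i + u s j)
        {(i, j). 1 \<le> i \<and> i \<le> j \<and> j \<le> r \<and> (\<rho> i + \<rho> j) mod n = s})"
proof (cases "r \<le> 2")
  case True
  have "inj_on (\<lambda>(i, j). (i - 1) + (j - 1))
        {(i, j). 1 \<le> i \<and> i \<le> j \<and> j \<le> r \<and> ((i - 1) + (j - 1)) mod 3 = s}" for s :: nat
    using True by (auto simp: inj_on_def)
  then show ?thesis
    using True assms(2) by (intro exI[of _ 3] exI[of _ "\<lambda>i. i - 1"] exI[of _ "\<lambda>s i. i - 1"]) auto
next
  case False
  define m h where "m = r div 2" and "h = (r + 1) div 2"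
  define n where "n = 2 * m + 1"
  define R where "R = {a. a < n \<and> (h = m \<longrightarrow> a \<noteq> m + 1)}"
  define \<rho> where "\<rho> i = (if h = m \<and> i > m + 1 then i else i - 1)" for i
  have h: "h = m \<or> h = m + 1" "h \<ge> 2"
    using False by (auto simp: h_def m_def)
  have "n * h = (r + 1) choose 2"
    by (cases "even r") (auto simp: n_def m_def h_def choose_two elim!: evenE oddE)
  then have d: "n * h div 2 \<le> d"
    using assms(1) by simp
  have r: "r = (if h = m then 2 * m else 2 * m + 1)"
    by (cases "even r") (auto simp: h_def m_def elim!: evenE oddE)
  have \<rho>: "\<rho> i \<in> R" if "i \<in> {1..r}" for i
    using that r by (auto simp: \<rho>_def R_def n_def split: if_splits)
  have \<rho>_mono: "\<rho> i < \<rho> j" if "1 \<le> i" "i < j" for i j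
    using that by (auto simp: \<rho>_def)
  have \<rho>_inj: "i = j" if "\<rho> i = \<rho> j" "1 \<le> i" "1 \<le> j" for i j
    using that \<rho>_mono[of i j] \<rho>_mono[of j i] by (metis less_irrefl linorder_neqE_nat)
  have \<rho>_le: "\<rho> i \<le> \<rho> j" if "1 \<le> i" "i \<le> j" for i j
    using that \<rho>_mono[of i j] by (cases "i = j") auto
  define good where "good s u \<longleftrightarrow> (\<forall>a\<in>R. u a \<le> n * h div 2 \<and> u a mod n = a) \<and>
    inj_on (\<lambda>(a, b). u a + u b) {(a, b). a \<in> R \<and> b \<in> R \<and> a \<le> b \<and> (a + b) mod n = s}" for s u
  have "\<exists>u. good s u" if "s < n" for s
    using class_exponents[OF h that[unfolded n_def]] unfolding good_def n_def R_def .
  then obtain u where good: "good s (u s)" if "s < n" for s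
    by metis
  have u: "u s a \<le> d" "u s a mod n = a" if "s < n" "a \<in> R" for s a
    using good[OF that(1)] that(2) d by (auto simp: good_def intro: order_trans)
  have inj: "inj_on (\<lambda>(a, b). u s a + u s b)
      {(a, b). a \<in> R \<and> b \<in> R \<and> a \<le> b \<and> (a + b) mod n = s}" if "s < n" for s
    using good[OF that] by (simp add: good_def)
  have "inj_on (\<lambda>(i, j). u s (\<rho> i) + u s (\<rho> j))
        {(i, j). 1 \<le> i \<and> i \<le> j \<and> j \<le> r \<and> (\<rho> i + \<rho> j) mod n = s}" if s: "s < n" for s
  proof (rule inj_onI)
    fix x y
    assume "x \<in> {(i, j). 1 \<le> i \<and> i \<le> j \<and> j \<le> r \<and> (\<rho> i + \<rho> j) mod n = s}"
      and "y \<in> {(i, j). 1 \<le> i \<and> i \<le> j \<and> j \<le> r \<and> (\<rho> i + \<rho> j) mod n = s}"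
      and eq: "(\<lambda>(i, j). u s (\<rho> i) + u s (\<rho> j)) x = (\<lambda>(i, j). u s (\<rho> i) + u s (\<rho> j)) y"
    then obtain i j i' j' where x: "x = (i, j)" "1 \<le> i" "i \<le> j" "j \<le> r" "(\<rho> i + \<rho> j) mod n = s"
      and y: "y = (i', j')" "1 \<le> i'" "i' \<le> j'" "j' \<le> r" "(\<rho> i' + \<rho> j') mod n = s"
      by blast
    have "(\<rho> i, \<rho> j) = (\<rho> i', \<rho> j')"
    proof (rule inj_onD[OF inj[OF s]])
      show "(\<rho> i, \<rho> j) \<in> {(a, b). a \<in> R \<and> b \<in> R \<and> a \<le> b \<and> (a + b) mod n = s}"
        using x(2-5) \<rho> \<rho>_le by simp
      show "(\<rho> i', \<rho> j') \<in> {(a, b). a \<in> R \<and> b \<in> R \<and> a \<le> b \<and> (a + b) mod n = s}"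
        using y(2-5) \<rho> \<rho>_le by simp
    qed (use eq x(1) y(1) in simp)
    then show "x = y"
      using \<rho>_inj[of i i'] \<rho>_inj[of j j'] x y by simp
  qed
  moreover have "n > 0" by (simp add: n_def)
  ultimately show ?thesis
    using u \<rho> by (intro exI[of _ n] exI[of _ \<rho>] exI[of _ "\<lambda>s i. u s (\<rho> i)"]) auto
qed

section \<open>Existence of quadratically independent forms\<close>

theorem theorem4p2:
  fixes d r :: nat
  assumes "infinite (UNIV :: 'k::field set)"
    and "d \<ge> 1" and "r \<ge> 1"
    and "(r + 1) choose 2 \<le> 2 * d + 1"
  shows "\<exists>p :: nat \<Rightarrow> 'k poly poly.
    (\<forall>i\<in>{1..r}. binary_form d (p i)) \<and> poly2.quadratically_independent r p"
proof -
  obtain n :: nat and \<rho> and u where "n > 0"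
    and u: "\<forall>s<n. (\<forall>i\<in>{1..r}. u s i \<le> d \<and> u s i mod n = \<rho> i) \<and>
      inj_on (\<lambda>(i, j). u s i + u s j)
        {(i, j). 1 \<le> i \<and> i \<le> j \<and> j \<le> r \<and> (\<rho> i + \<rho> j) mod n = s}"
    using distinct_sum_exponents[OF assms(4,2)] by blast
  show ?thesis
    by (rule quadratically_independent_forms_if_exponents[OF assms(1) \<open>n > 0\<close>, of r u d \<rho>])
      (use u in blast)+
qed

end
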